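(* For every integer $d \geq 3$, the layer number of the $d$-dimensional grid satisfies $\tau([n]^d) \leq O(n^{d-9/11})$; that is, for every $d \ge 3$ there is a constant $C_d > 0$ depending only on $d$ such that $\tau([n]^d) \leq C_d\, n^{d-9/11}$ for all sufficiently large positive integers $n$.
   Context: For a positive integer $n$, $[n]^d = \{1,\ldots,n\}^d \subset \mathbb{R}^d$. Given a finite point set $X \subset \mathbb{R}^d$, the peeling process is defined by $X_0 = X$ and $X_i = X_{i-1} \setminus \mathrm{ext}(X_{i-1})$ for $i \geq 1$, where $\mathrm{ext}(Y)$ is the set of extreme points of $Y$, i.e. the set of vertices of the convex hull of $Y$. The layer number $\tau(X)$ is the smallest index $i$ for which $X_i = \emptyset$. Asymptotic notation is for fixed $d$ as $n \to \infty$, with implied constants depending on $d$. *)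

theory Defs
  imports "HOL-Analysis.Analysis"
begin

definition ext :: "'a::real_vector set \<Rightarrow> 'a set" where
  "ext Y = {x. x extreme_point_of (convex hull Y)}"

primrec peel :: "'a::real_vector set \<Rightarrow> nat \<Rightarrow> 'a set" where
  "peel X 0 = X"
| "peel X (Suc i) = peel X i - ext (peel X i)"

text \<open>Meaningful for finite \<open>X\<close> only; \<open>peel_terminates\<close> below shows that the least
  index then exists.\<close>

definition layer_number :: "'a::real_vector set \<Rightarrow> nat" where
  "layer_number X = (LEAST i. peel X i = {})"

definition grid :: "nat \<Rightarrow> (real ^ 'd) set" where
  "grid n = {x. \<forall>i. x $ i \<in> real ` {1..n}}"

lemma finite_grid: "finite (grid n :: (real ^ 'd) set)"
proof -
  have "grid n \<subseteq> (\<lambda>f. \<chi> i. f i) ` (UNIV \<rightarrow>\<^sub>E real ` {1..n} :: ('d \<Rightarrow> real) set)"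
  proof
    fix x :: "real ^ 'd"
    assume "x \<in> grid n"
    then have "(\<lambda>i. x $ i) \<in> UNIV \<rightarrow>\<^sub>E real ` {1..n}"
      by (auto simp: grid_def)
    then show "x \<in> (\<lambda>f. \<chi> i. f i) ` (UNIV \<rightarrow>\<^sub>E real ` {1..n} :: ('d \<Rightarrow> real) set)"
      by (rule rev_image_eqI) simp
  qed
  moreover have "finite (UNIV \<rightarrow>\<^sub>E real ` {1..n} :: ('d \<Rightarrow> real) set)"
    by (rule finite_PiE) auto
  ultimately show ?thesis
    using finite_surj by blast
qed

lemma ext_subset: "ext Y \<subseteq> Y"
  unfolding ext_def using extreme_point_of_convex_hull by blast

lemma ext_nonempty:
  fixes Y :: "'a::euclidean_space set"
  assumes "finite Y" "Y \<noteq> {}"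
  shows "ext Y \<noteq> {}"
proof
  assume "ext Y = {}"
  moreover have "convex hull Y = convex hull (ext Y)"
    unfolding ext_def
    by (intro Krein_Milman_Minkowski finite_imp_compact_convex_hull convex_convex_hull assms)
  ultimately show False using assms by simp
qed

lemma peel_terminates:
  fixes X :: "'a::euclidean_space set"
  assumes "finite X"
  shows "\<exists>i. peel X i = {}"
proof -
  have fin: "finite (peel X i)" for i
    using assms by (induction i) auto
  have "peel X i = {} \<or> card (peel X i) + i \<le> card X" for i
  proof (induction i)
    case (Suc i)
    show ?case
    proof (cases "peel X i = {}")
      case False
      then have "peel X (Suc i) \<subset> peel X i"
        using ext_nonempty[OF fin False] ext_subset[of "peel X i"] by auto
      then have "card (peel X (Suc i)) < card (peel X i)"
        using fin psubset_card_mono by blast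
      then show ?thesis using Suc False by auto
    qed simp
  qed simp
  from this[of "Suc (card X)"] have "peel X (Suc (card X)) = {}"
    by (simp del: peel.simps)
  then show ?thesis by blast
qed

end

theory Submission
  imports Defs
begin

text \<open>Peeling a three-dimensional grid: for a direction \<open>u\<close> in \<open>{1..R}\<^sup>3\<close>, each step removes a
  vertex of the top face in direction \<open>u\<close>. A direction whose top face has at most \<open>T\<close> points
  is called good; as \<open>u\<close> takes at most \<open>3nR\<close> values on the grid, it is good during at most
  \<open>3nRT\<close> steps. At each step at least half of the primitive directions are good: a top face with
  more than \<open>T\<close> points either contains a long collinear set, so that \<open>u\<close> is orthogonal to
  an integer vector with entries at most \<open>A = n/T\<close>, which happens for \<open>O(A\<^sup>3R\<^sup>2)\<close> directions, or it
  contains a lattice triangle whose projection to the first two coordinates has area of order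
  \<open>RT\<close>. Triangles of distinct primitive directions have disjoint interiors in an \<open>n\<close> by \<open>n\<close>
  square, so the second alternative holds for \<open>O(n\<^sup>2/(RT))\<close> directions. Taking \<open>R\<close> of order \<open>A\<^sup>3\<close>
  and \<open>A\<close> of order \<open>n\<close> to the power \<open>1/11\<close>, double counting gives \<open>O(nRT) = O(n\<^sup>2A\<^sup>2)\<close> steps.
  In higher dimension, a linear functional in general position on the remaining \<open>d - 3\<close>
  coordinates singles out one three-dimensional slice at each step.\<close>

subsection \<open>Lattice points in a plane\<close>

text \<open>Bezout coefficients combine the entries of the primitive vector to 1. The same
  coefficients applied to \<open>r1\<close>, \<open>r2\<close>, \<open>r3\<close> give the integer
  \<open>s\<close>; the vanishing cross products turn \<open>s * v1\<close> into \<open>r1\<close>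
  times that combination, and likewise for the other entries.\<close>

lemma parallel_primitive:
  fixes v1 v2 v3 :: int
  assumes prim: "gcd v1 (gcd v2 v3) = 1"
    and par: "v1 * r2 = v2 * r1" "v1 * r3 = v3 * r1" "v2 * r3 = v3 * r2"
  obtains s where "r1 = s * v1" "r2 = s * v2" "r3 = s * v3"
proof -
  obtain l m where "l * v1 + m * gcd v2 v3 = 1"
    using bezout_int[of v1 "gcd v2 v3"] prim by metis
  moreover obtain m' m'' where "m' * v2 + m'' * v3 = gcd v2 v3"
    using bezout_int by metis
  ultimately have bez: "l * v1 + m * m' * v2 + m * m'' * v3 = 1"
    by (metis add.assoc distrib_left mult.assoc)
  define s where "s = l * r1 + m * m' * r2 + m * m'' * r3"
  have "s * v1 = r1 * (l * v1 + m * m' * v2 + m * m'' * v3)"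
    unfolding s_def using par by algebra
  moreover have "s * v2 = r2 * (l * v1 + m * m' * v2 + m * m'' * v3)"
    unfolding s_def using par by algebra
  moreover have "s * v3 = r3 * (l * v1 + m * m' * v2 + m * m'' * v3)"
    unfolding s_def using par by algebra
  ultimately show thesis using that[of s] bez by simp
qed

lemma primitive_part:
  fixes w1 w2 w3 :: int
  assumes "(w1, w2, w3) \<noteq> (0, 0, 0)"
  obtains g v1 v2 v3 where "g > 0" "gcd v1 (gcd v2 v3) = 1"
    "w1 = g * v1" "w2 = g * v2" "w3 = g * v3"
proof -
  define g where "g = gcd w1 (gcd w2 w3)"
  have g: "g > 0" using assms unfolding g_def by (auto simp: less_le)
  have "g dvd w1" "g dvd w2" "g dvd w3" unfolding g_def
    by (auto intro: dvd_trans[OF gcd_dvd2])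
  then obtain v1 v2 v3 where v: "w1 = g * v1" "w2 = g * v2" "w3 = g * v3"
    by (auto simp: dvd_def)
  have "g = g * gcd v1 (gcd v2 v3)"
    using g by (subst g_def) (simp add: v gcd_mult_left abs_mult)
  with g have "gcd v1 (gcd v2 v3) = 1" by simp
  from that[OF g this v] show thesis .
qed

lemma card_le_fibres:
  assumes "finite A" "\<And>y. y \<in> f ` A \<Longrightarrow> card {x \<in> A. f x = y} \<le> L"
  shows "card A \<le> card (f ` A) * L"
proof -
  have "card A = (\<Sum>y\<in>f ` A. card {x \<in> A. f x = y})"
    using assms(1) sum.image_gen[OF assms(1), of "\<lambda>_. 1::nat" f] by simp
  also have "\<dots> \<le> card (f ` A) * L"
    using sum_bounded_above[of "f ` A" "\<lambda>y. card {x \<in> A. f x = y}" L] assms(2) by simp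
  finally show ?thesis .
qed

text \<open>Take a line with the most points of \<open>F\<close>, say \<open>L\<close>. All of
  \<open>F\<close> lies on parallels to it, each with at most \<open>L\<close> points. If there is
  only one parallel, \<open>F\<close> is collinear and its primitive direction is the short vector.
  Otherwise the two ends of the line and a point on a farthest parallel span the large triangle: the
  line is at least \<open>L - 1\<close> primitive steps long, and the index of the farthest parallel
  bounds the number of parallels.\<close>

lemma thin_or_large_triangle:
  fixes X Y Z :: "'p \<Rightarrow> int"
  assumes fin: "finite F" and card: "card F \<ge> 2"
    and inj: "inj_on (\<lambda>p. (X p, Y p, Z p)) F"
    and prim: "gcd a (gcd b c) = 1" and c: "c > 0"
    and plane: "\<And>p. p \<in> F \<Longrightarrow> a * X p + b * Y p + c * Z p = h"
    and range: "\<And>p q. p \<in> F \<Longrightarrow> q \<in> F \<Longrightarrow> \<bar>X q - X p\<bar> \<le> n"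
      "\<And>p q. p \<in> F \<Longrightarrow> q \<in> F \<Longrightarrow> \<bar>Y q - Y p\<bar> \<le> n"
      "\<And>p q. p \<in> F \<Longrightarrow> q \<in> F \<Longrightarrow> \<bar>Z q - Z p\<bar> \<le> n"
  shows "(\<exists>v1 v2 v3. (v1, v2, v3) \<noteq> (0, 0, 0) \<and> a * v1 + b * v2 + c * v3 = 0 \<and>
            (int (card F) - 1) * \<bar>v1\<bar> \<le> n \<and> (int (card F) - 1) * \<bar>v2\<bar> \<le> n \<and>
            (int (card F) - 1) * \<bar>v3\<bar> \<le> n) \<or>
         (\<exists>p\<in>F. \<exists>q\<in>F. \<exists>r\<in>F. c * int (card F)
            \<le> 6 * \<bar>(X q - X p) * (Y r - Y p) - (Y q - Y p) * (X r - X p)\<bar>)"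
proof -
  \<comment> \<open>\<open>D\<close> is twice the signed area of the projected triangle. As
    \<open>c > 0\<close>, the projection to the first two coordinates is injective on the plane, so
    \<open>D p q r = 0\<close> expresses collinearity in the plane itself.\<close>
  define D where "D p q r = (X q - X p) * (Y r - Y p) - (Y q - Y p) * (X r - X p)" for p q r
  define Ln where "Ln p q = {r \<in> F. D p q r = 0}" for p q
  define Prs where "Prs = {(p, q). p \<in> F \<and> q \<in> F \<and> p \<noteq> q}"
  have finP: "finite Prs" unfolding Prs_def
    by (rule finite_subset[of _ "F \<times> F"]) (use fin in auto)
  obtain p0 q0 where "p0 \<in> F" "q0 \<in> F" "p0 \<noteq> q0"
    using card by (metis card_le_Suc0_iff_eq fin not_less_eq_eq numeral_2_eq_2)
  then have neP: "Prs \<noteq> {}" unfolding Prs_def by blast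
  define f where "f rs = card (case_prod Ln rs)" for rs
  define m where "m = Max (f ` Prs)"
  have "m \<in> f ` Prs" unfolding m_def using finP neP by (intro Max_in) auto
  then obtain pq where pq: "pq \<in> Prs" and pqM: "m = f pq" by (rule imageE)
  have pqmax: "f rs \<le> f pq" if "rs \<in> Prs" for rs
    unfolding pqM[symmetric] m_def using finP that by (intro Max_ge) auto
  obtain p q where pq_eq: "pq = (p, q)" by fastforce
  define L where "L = card (Ln p q)"
  have p: "p \<in> F" and q: "q \<in> F" and "p \<noteq> q" using pq pq_eq by (auto simp: Prs_def)
  have max: "card (Ln r s) \<le> L" if "r \<in> F" "s \<in> F" "r \<noteq> s" for r s
    using pqmax[of "(r, s)"] that by (simp add: pq_eq Prs_def L_def f_def)
  have finL: "finite (Ln p q)" using fin by (simp add: Ln_def)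
  have "{p, q} \<subseteq> Ln p q" using p q by (simp add: Ln_def D_def)
  from card_mono[OF finL this] have L2: "L \<ge> 2" using \<open>p \<noteq> q\<close> by (simp add: L_def)
  have "(X q - X p, Y q - Y p, Z q - Z p) \<noteq> (0, 0, 0)"
    using inj_onD[OF inj _ p q] \<open>p \<noteq> q\<close> by auto
  then obtain g v1 v2 v3 where g: "g > 0" and vprim: "gcd v1 (gcd v2 v3) = 1"
    and w: "X q - X p = g * v1" "Y q - Y p = g * v2" "Z q - Z p = g * v3"
    by (rule primitive_part)
  have "g * (a * v1 + b * v2 + c * v3) = a * (X q - X p) + b * (Y q - Y p) + c * (Z q - Z p)"
    by (simp add: w algebra_simps)
  also have "\<dots> = 0" using plane[OF p] plane[OF q] by (simp add: algebra_simps)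
  finally have uv: "a * v1 + b * v2 + c * v3 = 0" using g by simp
  \<comment> \<open>A cross product of two vectors of the plane is parallel to the normal
    \<open>(a, b, c)\<close>, and an integer multiple of it because the normal is primitive. The
    factor \<open>k r\<close> will number the parallels to the line through \<open>p\<close> and
    \<open>q\<close>.\<close>
  have "\<exists>k. v2 * (Z r - Z p) - v3 * (Y r - Y p) = k * a \<and>
            v3 * (X r - X p) - v1 * (Z r - Z p) = k * b \<and>
            v1 * (Y r - Y p) - v2 * (X r - X p) = k * c" if "r \<in> F" for r
  proof -
    have ur: "a * (X r - X p) + b * (Y r - Y p) + c * (Z r - Z p) = 0"
      using plane[OF p] plane[OF that] by (simp add: algebra_simps)
    let ?x = "v2 * (Z r - Z p) - v3 * (Y r - Y p)" and ?y = "v3 * (X r - X p) - v1 * (Z r - Z p)"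
      and ?z = "v1 * (Y r - Y p) - v2 * (X r - X p)"
    have "a * ?y = b * ?x" "a * ?z = c * ?x" "b * ?z = c * ?y"
      using ur uv by algebra+
    from parallel_primitive[OF prim this] show ?thesis by blast
  qed
  then obtain k where k: "\<And>r. r \<in> F \<Longrightarrow> v2 * (Z r - Z p) - v3 * (Y r - Y p) = k r * a"
    "\<And>r. r \<in> F \<Longrightarrow> v3 * (X r - X p) - v1 * (Z r - Z p) = k r * b"
    "\<And>r. r \<in> F \<Longrightarrow> v1 * (Y r - Y p) - v2 * (X r - X p) = k r * c"
    by metis
  have fibre: "\<exists>s. X t - X r = s * v1 \<and> Y t - Y r = s * v2 \<and> Z t - Z r = s * v3"
    if "r \<in> F" "t \<in> F" "k r = k t" for r t
  proof -
    have "v1 * (Y t - Y r) = v2 * (X t - X r)" "v1 * (Z t - Z r) = v3 * (X t - X r)"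
      "v2 * (Z t - Z r) = v3 * (Y t - Y r)"
      using k[OF that(1)] k[OF that(2)] that(3) by (simp_all add: algebra_simps)
    from parallel_primitive[OF vprim this] show ?thesis by blast
  qed
  have Lk: "Ln p q = {r \<in> F. k r = 0}"
  proof -
    have "D p q r = g * c * k r" if "r \<in> F" for r
      using k(3)[OF that] unfolding D_def w by algebra
    then show ?thesis using g c by (auto simp: Ln_def)
  qed
  have kp: "k p = 0" using p Lk \<open>{p, q} \<subseteq> Ln p q\<close> by auto
  obtain s where s: "\<And>r. r \<in> Ln p q \<Longrightarrow> X r - X p = s r * v1 \<and> Y r - Y p = s r * v2 \<and> Z r - Z p = s r * v3"
    using fibre[of p] p kp Lk by (metis (mono_tags, lifting) mem_Collect_eq)
  have "inj_on s (Ln p q)"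
  proof (rule inj_onI)
    fix x y assume "x \<in> Ln p q" "y \<in> Ln p q" "s x = s y"
    with s[of x] s[of y] have "X x = X y" "Y x = Y y" "Z x = Z y" by auto
    with inj_onD[OF inj, of x y] \<open>x \<in> Ln p q\<close> \<open>y \<in> Ln p q\<close> show "x = y" by (auto simp: Ln_def)
  qed
  then have cs: "card (s ` Ln p q) = L" by (simp add: L_def card_image)
  have ne: "s ` Ln p q \<noteq> {}" using cs L2 by auto
  obtain q' where q': "q' \<in> Ln p q" "s q' = Max (s ` Ln p q)"
    using Max_in[OF finite_imageI[OF finL] ne] by (metis imageE)
  obtain p' where p': "p' \<in> Ln p q" "s p' = Min (s ` Ln p q)"
    using Min_in[OF finite_imageI[OF finL] ne] by (metis imageE)
  \<comment> \<open>The length of the chosen line between its end points, in primitive steps. Its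
    \<open>L\<close> points have distinct integer parameters, whence
    \<open>d \<ge> L - 1\<close>.\<close>
  define d where "d = s q' - s p'"
  have "s ` Ln p q \<subseteq> {s p'..s q'}" using finL by (auto simp: q' p')
  from card_mono[OF _ this] have dL: "d \<ge> int L - 1" using cs L2 by (simp add: d_def)
  have p'F: "p' \<in> F" and q'F: "q' \<in> F" using p' q' by (auto simp: Ln_def)
  have dv: "X q' - X p' = d * v1" "Y q' - Y p' = d * v2" "Z q' - Z p' = d * v3"
    using s[OF p'(1)] s[OF q'(1)] by (auto simp: d_def algebra_simps)
  show ?thesis
  proof (cases "\<forall>r\<in>F. k r = 0")
    case True
    then have "Ln p q = F" using Lk by auto
    then have "L = card F" by (simp add: L_def)
    have "(int (card F) - 1) * \<bar>v\<bar> \<le> n" if "\<bar>d * v\<bar> \<le> n" for v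
    proof -
      have "(int (card F) - 1) * \<bar>v\<bar> \<le> d * \<bar>v\<bar>"
        using dL \<open>L = card F\<close> by (intro mult_right_mono) auto
      also have "\<dots> = \<bar>d * v\<bar>" using dL L2 by (simp add: abs_mult)
      finally show ?thesis using that by simp
    qed
    moreover have "\<bar>d * v1\<bar> \<le> n" "\<bar>d * v2\<bar> \<le> n" "\<bar>d * v3\<bar> \<le> n"
      using range[OF p'F q'F] dv by auto
    moreover have "(v1, v2, v3) \<noteq> (0, 0, 0)" using vprim by auto
    ultimately show ?thesis using uv by blast
  next
    case False
    define M where "M = Max ((\<lambda>r. \<bar>k r\<bar>) ` F)"
    obtain r where r: "r \<in> F" "\<bar>k r\<bar> = M"
      using Max_in[of "(\<lambda>r. \<bar>k r\<bar>) ` F"] fin p unfolding M_def by fastforce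
    have kM: "\<bar>k t\<bar> \<le> M" if "t \<in> F" for t
      unfolding M_def using fin that by (intro Max_ge) auto
    have M1: "M \<ge> 1" using False kM by (smt (verit))
    have "k ` F \<subseteq> {-M..M}" using kM by fastforce
    from card_mono[OF _ this] have ck: "int (card (k ` F)) \<le> 2 * M + 1" using M1 by simp
    \<comment> \<open>A parallel with two points lies in the line through them, which has at most
      \<open>L\<close> points by maximality; any other parallel has at most one point.\<close>
    have "card {t \<in> F. k t = y} \<le> L" for y
    proof (cases "\<exists>t1 t2. t1 \<in> F \<and> t2 \<in> F \<and> k t1 = y \<and> k t2 = y \<and> t1 \<noteq> t2")
      case True
      then obtain t1 t2 where t: "t1 \<in> F" "t2 \<in> F" "k t1 = y" "k t2 = y" "t1 \<noteq> t2" by blast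
      have "{t \<in> F. k t = y} \<subseteq> Ln t1 t2"
      proof clarify
        fix x assume x: "x \<in> F" "y = k x"
        obtain s1 where "X x - X t1 = s1 * v1" "Y x - Y t1 = s1 * v2"
          using fibre[of t1 x] x t by metis
        moreover obtain s2 where "X t2 - X t1 = s2 * v1" "Y t2 - Y t1 = s2 * v2"
          using fibre[of t1 t2] t by metis
        ultimately show "x \<in> Ln t1 t2" using x by (simp add: Ln_def D_def)
      qed
      from card_mono[OF _ this] have "card {t \<in> F. k t = y} \<le> card (Ln t1 t2)"
        using fin by (simp add: Ln_def)
      also have "\<dots> \<le> L" using max t by blast
      finally show ?thesis .
    next
      case False
      then have "card {t \<in> F. k t = y} \<le> 1"
        using fin by (auto simp: card_le_Suc0_iff_eq)
      then show ?thesis using L2 by simp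
    qed
    from card_le_fibres[OF fin this] have "int (card F) \<le> int (card (k ` F)) * int L"
      by (metis of_nat_le_iff of_nat_mult)
    also have "\<dots> \<le> (2 * M + 1) * int L" using ck by (intro mult_right_mono) auto
    \<comment> \<open>\<open>M \<ge> 1\<close> gives \<open>2 * M + 1 \<le> 3 * M\<close>, and
      \<open>L \<ge> 2\<close> gives \<open>L \<le> d + 1 \<le> 2 * d\<close>. This is the origin of
      the factor 6.\<close>
    also have "\<dots> \<le> (3 * M) * (2 * d)" using dL L2 M1 by (intro mult_mono) auto
    finally have "c * int (card F) \<le> c * (6 * (d * M))" using c by (intro mult_left_mono) (auto simp: mult.commute)
    also have "\<dots> = 6 * \<bar>d * (c * k r)\<bar>" using c r dL L2 by (simp add: abs_mult)
    also have "d * (c * k r) = D p' q' r"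
    proof -
      have "D p' q' r = d * (v1 * (Y r - Y p') - v2 * (X r - X p'))"
        unfolding D_def dv by algebra
      \<comment> \<open>The base point may move from \<open>p\<close> to \<open>p'\<close> since
        both lie on the line in direction \<open>(v1, v2, v3)\<close>.\<close>
      also have "v1 * (Y r - Y p') - v2 * (X r - X p') = v1 * (Y r - Y p) - v2 * (X r - X p)"
        using s[OF p'(1)] by algebra
      also have "\<dots> = c * k r" using k(3)[OF r(1)] by simp
      finally show ?thesis by simp
    qed
    finally show ?thesis using p'F q'F r(1) unfolding D_def by blast
  qed
qed

subsection \<open>Triangles in distinct supporting planes\<close>

text \<open>Read the supporting planes as graphs over the first two coordinates. Over its own
  triangle each plane is the lowest of all, so two planes agree where their triangles overlap.
  Distinct primitive normals with positive last entry give distinct gradients, so an overlap lies in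
  a line and has measure zero. Triangles of area at least \<open>D / 2\<close> are thus packed into
  a square of area \<open>n\<^sup>2\<close>.\<close>

lemma disjoint_triangles_bound:
  fixes X Y Z :: "'p \<Rightarrow> int" and n :: nat and D :: real
  assumes fin: "finite U"
    and U: "\<And>a b c. (a, b, c) \<in> U \<Longrightarrow> c > 0 \<and> gcd a (gcd b c) = 1"
    and box: "\<And>p. p \<in> S \<Longrightarrow> X p \<in> {0..int n} \<and> Y p \<in> {0..int n}"
    and tri: "\<And>a b c. (a, b, c) \<in> U \<Longrightarrow> \<exists>p\<in>S. \<exists>q\<in>S. \<exists>r\<in>S.
       (\<forall>x\<in>{p, q, r}. \<forall>y\<in>S. a * X y + b * Y y + c * Z y \<le> a * X x + b * Y x + c * Z x) \<and>
       D \<le> real_of_int \<bar>(X q - X p) * (Y r - Y p) - (Y q - Y p) * (X r - X p)\<bar>"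
  shows "real (card U) * D \<le> 2 * (real n)\<^sup>2"
proof -
  define vec2 :: "'p \<Rightarrow> real^2" where "vec2 p = vector [of_int (X p), of_int (Y p)]" for p
  have v2: "vec2 p $ 1 = of_int (X p)" "vec2 p $ 2 = of_int (Y p)" for p
    by (auto simp: vec2_def)
  define ht where "ht u p = (case u of (a, b, c) \<Rightarrow> a * X p + b * Y p + c * Z p)" for u :: "int \<times> int \<times> int" and p
  have "\<forall>u\<in>U. \<exists>p q r. {p, q, r} \<subseteq> S \<and> (\<forall>x\<in>{p, q, r}. \<forall>y\<in>S. ht u y \<le> ht u x) \<and>
       D \<le> real_of_int \<bar>(X q - X p) * (Y r - Y p) - (Y q - Y p) * (X r - X p)\<bar>"
  proof
    fix u assume "u \<in> U"
    obtain a b c where u: "u = (a, b, c)" by (metis prod_cases3)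
    from tri[of a b c] \<open>u \<in> U\<close> u obtain p q r where "p \<in> S" "q \<in> S" "r \<in> S"
      "(\<forall>x\<in>{p, q, r}. \<forall>y\<in>S. ht u y \<le> ht u x)"
       "D \<le> real_of_int \<bar>(X q - X p) * (Y r - Y p) - (Y q - Y p) * (X r - X p)\<bar>"
      unfolding ht_def by auto
    then show "\<exists>p q r. {p, q, r} \<subseteq> S \<and> (\<forall>x\<in>{p, q, r}. \<forall>y\<in>S. ht u y \<le> ht u x) \<and>
       D \<le> real_of_int \<bar>(X q - X p) * (Y r - Y p) - (Y q - Y p) * (X r - X p)\<bar>"
      by (intro exI[of _ p] exI[of _ q] exI[of _ r]) simp
  qed
  then obtain p q r where pqrS: "\<And>u. u \<in> U \<Longrightarrow> {p u, q u, r u} \<subseteq> S"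
    and top: "\<And>u x y. u \<in> U \<Longrightarrow> x \<in> {p u, q u, r u} \<Longrightarrow> y \<in> S \<Longrightarrow> ht u y \<le> ht u x"
    and area: "\<And>u. u \<in> U \<Longrightarrow> D \<le> real_of_int \<bar>(X (q u) - X (p u)) * (Y (r u) - Y (p u)) - (Y (q u) - Y (p u)) * (X (r u) - X (p u))\<bar>"
    by metis
  define tr where "tr u = convex hull {vec2 (p u), vec2 (q u), vec2 (r u)}" for u
  \<comment> \<open>The supporting plane with normal \<open>u\<close> has height
    \<open>H u w = off u - grad u \<bullet> w\<close> over \<open>w\<close>, so
    \<open>grad u\<close> is the negative of its gradient.\<close>
  define grad :: "int \<times> int \<times> int \<Rightarrow> real^2"
    where "grad u = (case u of (a, b, c) \<Rightarrow> vector [of_int a / of_int c, of_int b / of_int c])" for u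
  define off where "off u = (case u of (a, b, c) \<Rightarrow> of_int (ht u (p u)) / real_of_int c)" for u
  define H where "H u w = off u - grad u \<bullet> w" for u w
  \<comment> \<open>For fixed \<open>u\<close> and \<open>u'\<close> this is a half-plane condition
    on \<open>w\<close>, so on a triangle it needs checking only at the vertices.\<close>
  have H_le: "H u w \<le> H u' w \<longleftrightarrow> (grad u' - grad u) \<bullet> w \<le> off u' - off u" for u u' w
    by (auto simp: H_def inner_diff_left)
  have H_vec2: "H (a, b, c) (vec2 x)
      = (of_int (ht (a, b, c) (p (a, b, c))) - of_int a * of_int (X x) - of_int b * of_int (Y x)) / of_int c"
    for a b c x
    by (simp add: H_def off_def grad_def inner_vec_def sum_2 v2 diff_divide_distrib)
  text \<open>Above a point of its triangle the supporting plane of \<open>u\<close> touches the convex hull of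
    \<open>S\<close>, so it lies below every other supporting plane.\<close>
  have below: "H u w \<le> H u' w" if "u \<in> U" "u' \<in> U" "w \<in> tr u" for u u' w
  proof -
    obtain a b c where u: "u = (a, b, c)" by (metis prod_cases3)
    obtain a' b' c' where u': "u' = (a', b', c')" by (metis prod_cases3)
    have c: "c > 0" "c' > 0" using U that u u' by auto
    have "vec2 x \<in> {w. (grad u' - grad u) \<bullet> w \<le> off u' - off u}" if x: "x \<in> {p u, q u, r u}" for x
    proof -
      have xS: "x \<in> S" "p u \<in> S" using x pqrS[OF \<open>u \<in> U\<close>] by auto
      have "ht u x = ht u (p u)"
        using top[OF \<open>u \<in> U\<close>, of x "p u"] top[OF \<open>u \<in> U\<close>, of "p u" x] x xS by simp
      then have "H u (vec2 x) = of_int (Z x)"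
        unfolding u H_vec2 using c by (simp add: ht_def field_simps flip: of_int_mult of_int_add)
      moreover have "ht u' x \<le> ht u' (p u')" using top[OF \<open>u' \<in> U\<close>, of "p u'" x] xS by simp
      then have "real_of_int (ht u' x) \<le> of_int (ht u' (p u'))" by simp
      then have "of_int (Z x) \<le> H u' (vec2 x)"
        unfolding u' H_vec2 using c by (simp add: ht_def field_simps)
      ultimately show ?thesis using H_le[of u "vec2 x" u'] by simp
    qed
    then have "tr u \<subseteq> {w. (grad u' - grad u) \<bullet> w \<le> off u' - off u}" unfolding tr_def
      by (intro hull_minimal convex_halfspace_le) auto
    then show ?thesis using H_le that by auto
  qed
  have negl: "pairwise (\<lambda>u u'. negligible (tr u \<inter> tr u')) U"
  proof (rule pairwiseI)
    fix u u' assume uU: "u \<in> U" "u' \<in> U" and "u \<noteq> u'"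
    obtain a b c where u: "u = (a, b, c)" by (metis prod_cases3)
    obtain a' b' c' where u': "u' = (a', b', c')" by (metis prod_cases3)
    have c: "c > 0" "c' > 0" and prim: "gcd a (gcd b c) = 1" "gcd a' (gcd b' c') = 1"
      using U uU u u' by auto
    have "grad u' - grad u \<noteq> 0"
    proof
      assume "grad u' - grad u = 0"
      then have "grad u' $ 1 = grad u $ 1" "grad u' $ 2 = grad u $ 2" by auto
      then have "real_of_int (a' * c) = real_of_int (a * c')" "real_of_int (b' * c) = real_of_int (b * c')"
        using c unfolding grad_def u u' by (simp_all add: field_simps)
      then have e: "a' * c = a * c'" "b' * c = b * c'" by linarith+
      \<comment> \<open>The two normals are now proportional; scaling each by the last entry of the
        other and comparing gcds yields \<open>c = c'\<close>.\<close>
      have "c = c * gcd a' (gcd b' c')" using prim by simp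
      also have "\<dots> = gcd (c * a') (gcd (c * b') (c * c'))"
        using c by (simp add: gcd_mult_left abs_mult)
      also have "\<dots> = gcd (c' * a) (gcd (c' * b) (c' * c))" using e by (simp add: mult.commute)
      also have "\<dots> = c' * gcd a (gcd b c)" using c by (simp add: gcd_mult_left abs_mult)
      finally have "c = c'" using prim by simp
      with e c u u' \<open>u \<noteq> u'\<close> show False by simp
    qed
    then have "negligible {w. (grad u' - grad u) \<bullet> w = off u' - off u}"
      by (intro negligible_hyperplane) simp
    moreover have "tr u \<inter> tr u' \<subseteq> {w. (grad u' - grad u) \<bullet> w = off u' - off u}"
    proof
      fix w assume w: "w \<in> tr u \<inter> tr u'"
      then have "H u w = H u' w" using below[OF uU, of w] below[OF uU(2,1), of w] by auto
      then show "w \<in> {w. (grad u' - grad u) \<bullet> w = off u' - off u}"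
        by (simp add: H_def inner_diff_left)
    qed
    ultimately show "negligible (tr u \<inter> tr u')" by (rule negligible_subset)
  qed
  have meas: "tr u \<in> lmeasurable" for u
    unfolding tr_def by (intro lmeasurable_compact finite_imp_compact_convex_hull) simp
  let ?B = "cbox 0 (vector [real n, real n]) :: (real^2) set"
  have "real (card U) * (D / 2) = (\<Sum>u\<in>U. D / 2)" by simp
  also have "\<dots> \<le> (\<Sum>u\<in>U. measure lebesgue (tr u))"
  proof (rule sum_mono)
    fix u assume "u \<in> U"
    have "measure lebesgue (tr u) = measure lborel (tr u)"
      unfolding tr_def by (intro measure_completion) (simp add: borel_compact finite_imp_compact_convex_hull)
    also have "\<dots> = \<bar>real_of_int \<bar>(X (q u) - X (p u)) * (Y (r u) - Y (p u)) - (Y (q u) - Y (p u)) * (X (r u) - X (p u))\<bar>\<bar> / 2"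
      unfolding tr_def content_triangle v2 by (simp add: abs_minus_commute mult.commute)
    finally show "D / 2 \<le> measure lebesgue (tr u)" using area[OF \<open>u \<in> U\<close>] by simp
  qed
  also have "\<dots> = measure lebesgue (\<Union>(tr ` U))"
    using measure_negligible_finite_Union_image[OF fin meas negl] by simp
  also have "\<dots> \<le> measure lebesgue ?B"
  proof (rule measure_mono_fmeasurable)
    show "\<Union>(tr ` U) \<subseteq> ?B"
    proof (intro UN_least)
      fix u assume "u \<in> U"
      have "vec2 x \<in> ?B" if "x \<in> S" for x
        using box[OF that] by (auto simp: mem_box_cart forall_2 v2)
      then show "tr u \<subseteq> ?B" unfolding tr_def
        using pqrS[OF \<open>u \<in> U\<close>] by (intro hull_minimal convex_box) auto
    qed
    show "\<Union>(tr ` U) \<in> sets lebesgue" using fin meas by (intro sets.finite_UN) auto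
  qed simp
  also have "\<dots> = measure lborel ?B" by simp
  also have "\<dots> = (real n)\<^sup>2"
    by (subst content_cbox_cart) (auto simp: interval_eq_empty_cart forall_2 prod_2 power2_eq_square UNIV_2)
  finally show ?thesis by simp
qed

subsection \<open>Primitive directions\<close>

text \<open>The condition \<open>R \<le> 4c\<close> keeps the projections of lattice triangles large.\<close>

definition directions :: "nat \<Rightarrow> (int \<times> int \<times> int) set" where
  "directions R = {(a, b, c). a \<in> {1..int R} \<and> b \<in> {1..int R} \<and> c \<in> {1..int R} \<and>
     gcd a (gcd b c) = 1 \<and> int R \<le> 4 * c}"

lemma finite_directions: "finite (directions R)"
  by (rule finite_subset[of _ "{1..int R} \<times> {1..int R} \<times> {1..int R}"])
     (auto simp: directions_def)

lemma card_multiples: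
  assumes "k \<ge> 1"
  shows "real (card {a \<in> {1..int R}. int k dvd a}) \<le> real R / real k"
proof -
  have "{a \<in> {1..int R}. int k dvd a} \<subseteq> (\<lambda>j. int k * j) ` {1..int (R div k)}"
  proof
    fix a assume a: "a \<in> {a \<in> {1..int R}. int k dvd a}"
    then obtain j where j: "a = int k * j" by auto
    with a assms have "j \<ge> 1" by (smt (verit) mem_Collect_eq atLeastAtMost_iff mult_nonneg_nonpos of_nat_0_le_iff)
    moreover have "j \<le> int R div int k" using a j assms
      by (metis (mono_tags, lifting) atLeastAtMost_iff mem_Collect_eq nonzero_mult_div_cancel_left of_nat_0_le_iff of_nat_eq_0_iff not_one_le_zero zdiv_mono1 of_nat_0_less_iff less_le)
    ultimately show "a \<in> (\<lambda>j. int k * j) ` {1..int (R div k)}" using j by (auto simp: zdiv_int)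
  qed
  from surj_card_le[OF _ this] have "card {a \<in> {1..int R}. int k dvd a} \<le> R div k" by simp
  then have "real (card {a \<in> {1..int R}. int k dvd a}) \<le> real (R div k)" by simp
  also have "\<dots> \<le> real R / real k" by (rule of_nat_div_le_of_nat)
  finally show ?thesis .
qed

text \<open>Each \<open>1 / k ^ 3\<close> is at most \<open>1 / ((k - 1) * k * (k + 1))\<close>,
  whose sum telescopes; the induction carries the exact remainder.\<close>

lemma sum_inverse_cubes: "(\<Sum>k=2..m. 1 / real k ^ 3) \<le> 1 / 4"
proof -
  have "m \<ge> 1 \<Longrightarrow> (\<Sum>k=2..m. 1 / real k ^ 3) \<le> 1 / 4 - 1 / (2 * real m * (real m + 1))"
  proof (induction m rule: nat_induct_at_least)
    case (Suc m)
    define x where "x = real m"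
    have x: "x \<ge> 1" using Suc by (simp add: x_def)
    have "1 / (x * (x + 1) * (x + 2)) = 1 / (2 * x * (x + 1)) - 1 / (2 * (x + 1) * (x + 2))"
      using x by (simp add: divide_simps) (simp add: algebra_simps)
    moreover have "1 / (x + 1) ^ 3 \<le> 1 / (x * (x + 1) * (x + 2))"
      using x by (intro divide_left_mono mult_pos_pos) (auto simp: power3_eq_cube algebra_simps intro!: add_pos_nonneg)
    ultimately have "1 / (x + 1) ^ 3 \<le> 1 / (2 * x * (x + 1)) - 1 / (2 * (x + 1) * (x + 2))" by simp
    with Suc show ?case by (simp add: x_def algebra_simps)
  qed simp
  moreover have "1 / (2 * real m * (real m + 1)) \<ge> 0" by simp
  ultimately show ?thesis by (cases "m \<ge> 1") (linarith, simp)
qed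

text \<open>Among the \<open>R ^ 3\<close> triples, those with a common divisor
  \<open>k \<ge> 2\<close> number at most the sum of \<open>(R / k) ^ 3\<close>, hence at most a
  quarter; those with \<open>4 * c < R\<close> are at most another quarter.\<close>

lemma card_directions:
  assumes "R \<ge> 1"
  shows "real (card (directions R)) \<ge> real R ^ 3 / 2"
proof -
  let ?I = "{1..int R}"
  let ?T = "\<lambda>k. {a \<in> ?I. int k dvd a}"
  let ?N = "\<Union>k\<in>{2..R}. ?T k \<times> ?T k \<times> ?T k"
  let ?L = "?I \<times> ?I \<times> {c \<in> ?I. 4 * c < int R}"
  have finT: "finite (?T k)" for k by (rule finite_subset[of _ ?I]) auto
  have "?I \<times> ?I \<times> ?I \<subseteq> directions R \<union> (?N \<union> ?L)"
  proof
    fix x assume "x \<in> ?I \<times> ?I \<times> ?I"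
    then obtain a b c where x: "x = (a, b, c)" and abc: "a \<in> ?I" "b \<in> ?I" "c \<in> ?I" by blast
    have "x \<in> ?N" if L: "x \<notin> ?L" and D: "x \<notin> directions R"
    proof -
    define g where "g = gcd a (gcd b c)"
    have g1: "g \<noteq> 1" using abc L D x by (auto simp: directions_def g_def)
    have d: "g dvd a" "g dvd b" "g dvd c" unfolding g_def by (auto intro: dvd_trans[OF gcd_dvd2])
    have "g \<ge> 0" "g \<noteq> 0" unfolding g_def using abc by auto
    moreover have "g \<le> int R" using zdvd_imp_le[OF d(1)] abc by auto
    ultimately have "nat g \<in> {2..R}" "int (nat g) = g" using g1 by auto
    with abc d x show ?thesis by (intro UN_I[of "nat g"]) auto
    qed
    then show "x \<in> directions R \<union> (?N \<union> ?L)" by blast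
  qed
  moreover have "finite {c \<in> ?I. 4 * c < int R}" by (rule finite_subset[of _ ?I]) auto
  then have "finite (directions R \<union> (?N \<union> ?L))"
    by (intro finite_UnI finite_UN_I finite_cartesian_product finT finite_directions) auto
  ultimately have "card (?I \<times> ?I \<times> ?I) \<le> card (directions R \<union> (?N \<union> ?L))"
    by (intro card_mono)
  also have "\<dots> \<le> card (directions R) + (card ?N + card ?L)"
    by (intro order_trans[OF card_Un_le] add_left_mono card_Un_le)
  finally have "real (card (?I \<times> ?I \<times> ?I)) \<le> real (card (directions R)) + (real (card ?N) + real (card ?L))"
    by linarith
  moreover have "real (card (?I \<times> ?I \<times> ?I)) = real R ^ 3"
    by (simp add: card_cartesian_product power3_eq_cube)
  moreover have "real (card ?N) \<le> real R ^ 3 / 4"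
  proof -
    have "card ?N \<le> (\<Sum>k\<in>{2..R}. card (?T k \<times> ?T k \<times> ?T k))" by (intro card_UN_le) simp
    then have "real (card ?N) \<le> real (\<Sum>k\<in>{2..R}. card (?T k \<times> ?T k \<times> ?T k))" by (simp only: of_nat_le_iff)
    also have "\<dots> = (\<Sum>k\<in>{2..R}. real (card (?T k)) ^ 3)"
      by (simp add: card_cartesian_product power3_eq_cube mult.assoc)
    also have "\<dots> \<le> (\<Sum>k\<in>{2..R}. (real R / real k) ^ 3)"
      by (intro sum_mono power_mono card_multiples) auto
    also have "\<dots> = real R ^ 3 * (\<Sum>k\<in>{2..R}. 1 / real k ^ 3)"
      by (simp add: sum_distrib_left power_divide)
    also have "\<dots> \<le> real R ^ 3 * (1 / 4)"
      by (intro mult_left_mono sum_inverse_cubes) auto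
    finally show ?thesis by simp
  qed
  moreover have "real (card ?L) \<le> real R ^ 3 / 4"
  proof -
    have "{c \<in> ?I. 4 * c < int R} \<subseteq> {1..int (R div 4)}" by auto
    from card_mono[OF _ this] have "card {c \<in> ?I. 4 * c < int R} \<le> R div 4" by simp
    then have "real (card {c \<in> ?I. 4 * c < int R}) \<le> real R / 4" by linarith
    then have "real R ^ 2 * real (card {c \<in> ?I. 4 * c < int R}) \<le> real R ^ 2 * (real R / 4)"
      by (intro mult_left_mono) auto
    then show ?thesis by (simp add: card_cartesian_product power3_eq_cube power2_eq_square)
  qed
  ultimately show ?thesis by simp
qed

text \<open>The coordinate with a nonzero coefficient is determined by the other two.\<close>

lemma card_orthogonal:
  fixes v1 v2 v3 :: int
  assumes "(v1, v2, v3) \<noteq> (0, 0, 0)"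
  shows "card {(a, b, c). a \<in> {1..int R} \<and> b \<in> {1..int R} \<and> c \<in> {1..int R} \<and>
     a * v1 + b * v2 + c * v3 = 0} \<le> R ^ 2" (is "card ?S \<le> _")
proof -
  have *: "card ?S \<le> R ^ 2" if "inj_on f ?S" "f ` ?S \<subseteq> {1..int R} \<times> {1..int R}" for f :: "_ \<Rightarrow> int \<times> int"
    using card_inj_on_le[OF that] by (simp add: power2_eq_square)
  consider "v1 \<noteq> 0" | "v2 \<noteq> 0" | "v3 \<noteq> 0" using assms by auto
  then show ?thesis
  proof cases
    case 1
    then show ?thesis
      by (intro *[of "\<lambda>(a, b, c). (b, c)"]) (auto simp: inj_on_def, metis add_left_cancel add_right_cancel mult_cancel_right)
  next
    case 2
    then show ?thesis
      by (intro *[of "\<lambda>(a, b, c). (a, c)"]) (auto simp: inj_on_def, metis add_left_cancel add_right_cancel mult_cancel_right)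
  next
    case 3
    then show ?thesis
      by (intro *[of "\<lambda>(a, b, c). (a, b)"]) (auto simp: inj_on_def, metis add_left_cancel add_right_cancel mult_cancel_right)
  qed
qed

text \<open>A union bound over the short vectors. It counts the directions whose top face may be a
  long collinear set.\<close>

lemma card_directions_orthogonal:
  "card {(a, b, c) \<in> directions R. \<exists>v1 v2 v3. (v1, v2, v3) \<noteq> (0, 0, 0) \<and> a * v1 + b * v2 + c * v3 = 0 \<and>
     \<bar>v1\<bar> \<le> int A \<and> \<bar>v2\<bar> \<le> int A \<and> \<bar>v3\<bar> \<le> int A} \<le> (2 * A + 1) ^ 3 * R ^ 2"
proof -
  let ?V = "{-int A..int A} \<times> {-int A..int A} \<times> {-int A..int A} - {(0, 0, 0)}"
  let ?S = "\<lambda>(v1, v2, v3). {(a, b, c). a \<in> {1..int R} \<and> b \<in> {1..int R} \<and> c \<in> {1..int R} \<and>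
     a * v1 + b * v2 + c * v3 = 0}"
  have finS: "finite (?S v)" for v
    by (rule finite_subset[of _ "{1..int R} \<times> {1..int R} \<times> {1..int R}"]) (auto split: prod.splits)
  have "{(a, b, c) \<in> directions R. \<exists>v1 v2 v3. (v1, v2, v3) \<noteq> (0, 0, 0) \<and> a * v1 + b * v2 + c * v3 = 0 \<and>
     \<bar>v1\<bar> \<le> int A \<and> \<bar>v2\<bar> \<le> int A \<and> \<bar>v3\<bar> \<le> int A} \<subseteq> (\<Union>v\<in>?V. ?S v)" (is "?B \<subseteq> _")
  proof
    fix x assume "x \<in> ?B"
    moreover obtain a b c where x: "x = (a, b, c)" by (metis prod_cases3)
    ultimately obtain v1 v2 v3 where "(a, b, c) \<in> directions R" "(v1, v2, v3) \<noteq> (0, 0, 0)"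
      "a * v1 + b * v2 + c * v3 = 0" "\<bar>v1\<bar> \<le> int A" "\<bar>v2\<bar> \<le> int A" "\<bar>v3\<bar> \<le> int A"
      by (simp only: mem_Collect_eq prod.case) blast
    then show "x \<in> (\<Union>v\<in>?V. ?S v)" unfolding x
      by (intro UN_I[of "(v1, v2, v3)"]) (auto simp: directions_def)
  qed
  from card_mono[OF _ this] have "card ?B \<le> card (\<Union>v\<in>?V. ?S v)" using finS by blast
  also have "\<dots> \<le> (\<Sum>v\<in>?V. card (?S v))" by (intro card_UN_le) simp
  also have "\<dots> \<le> (\<Sum>v\<in>?V. R ^ 2)"
  proof (rule sum_mono)
    fix v assume "v \<in> ?V"
    moreover obtain v1 v2 v3 where v: "v = (v1, v2, v3)" by (metis prod_cases3)
    ultimately have "(v1, v2, v3) \<noteq> (0, 0, 0)" by auto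
    from card_orthogonal[OF this, of R] show "card (?S v) \<le> R ^ 2" unfolding v prod.case .
  qed
  also have "\<dots> = card ?V * R ^ 2" by simp
  also have "\<dots> \<le> (2 * A + 1) ^ 3 * R ^ 2"
  proof (rule mult_right_mono)
    have "card ?V \<le> card ({-int A..int A} \<times> {-int A..int A} \<times> {-int A..int A})"
      by (intro card_mono) auto
    also have "\<dots> = (2 * A + 1) ^ 3"
    proof -
      have "card {-int A..int A} = 2 * A + 1" unfolding card_atLeastAtMost_int by linarith
      then show ?thesis by (simp only: card_cartesian_product power3_eq_cube mult.assoc)
    qed
    finally show "card ?V \<le> (2 * A + 1) ^ 3" .
  qed simp
  finally show ?thesis .
qed

subsection \<open>The three-dimensional bound\<close>

text \<open>Double counting of pairs \<open>(j, u)\<close> with \<open>u\<close> good at step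
  \<open>j\<close>: every \<open>j\<close> in \<open>J\<close> has at least half of all directions,
  every direction has at most \<open>3 * n * R * T\<close> steps. The sets \<open>S j\<close> are
  left abstract because they will be one slice of a higher-dimensional grid, which need lose points
  only at the steps in \<open>J\<close>.\<close>

lemma peeling_steps_3d:
  fixes X Y Z :: "'p \<Rightarrow> int" and S :: "nat \<Rightarrow> 'p set" and n A R T :: nat
  assumes finJ: "finite J"
    and fin: "\<And>j. finite (S j)"
    and dec: "\<And>j k. j \<le> k \<Longrightarrow> S k \<subseteq> S j"
    and box: "\<And>j p. p \<in> S j \<Longrightarrow> X p \<in> {1..int n} \<and> Y p \<in> {1..int n} \<and> Z p \<in> {1..int n}"
    and inj: "\<And>j. inj_on (\<lambda>p. (X p, Y p, Z p)) (S j)"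
    and removed: "\<And>j a b c. j \<in> J \<Longrightarrow> a > 0 \<Longrightarrow> b > 0 \<Longrightarrow> c > 0 \<Longrightarrow>
      \<exists>p\<in>S j - S (Suc j). \<forall>q\<in>S j. a * X q + b * Y q + c * Z q \<le> a * X p + b * Y p + c * Z p"
    and AT: "n \<le> A * T" and T: "T \<ge> 1" and R: "8 * (2 * A + 1) ^ 3 \<le> R"
    and RT: "384 * n ^ 2 \<le> R ^ 4 * T"
  shows "card J \<le> 6 * n * R * T"
proof -
  define ht where "ht u p = (case u of (a, b, c) \<Rightarrow> a * X p + b * Y p + c * Z p)" for u :: "int \<times> int \<times> int" and p
  define top where "top j u = {p \<in> S j. \<forall>q\<in>S j. ht u q \<le> ht u p}" for j u
  define U where "U = directions R"
  define good where "good j u \<longleftrightarrow> card (top j u) \<le> T" for j u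
  have "(2 * A + 1) ^ 3 \<ge> 1" by (rule one_le_power) simp
  with R have R1: "R \<ge> 1" by linarith
  have finU: "finite U" by (simp add: U_def finite_directions)
  have cardU: "real (card U) \<ge> real R ^ 3 / 2" using card_directions[OF R1] by (simp add: U_def)
  have removed': "\<exists>p. p \<in> top j u \<and> p \<notin> S (Suc j)" if "j \<in> J" "u \<in> U" for j u
  proof -
    obtain a b c where u: "u = (a, b, c)" by (metis prod_cases3)
    have "a > 0" "b > 0" "c > 0" using that u by (auto simp: U_def directions_def)
    from removed[OF that(1) this] show ?thesis unfolding top_def ht_def u by auto
  qed
  have fintop: "finite (top j u)" for j u using fin by (simp add: top_def)

  \<comment> \<open>\<open>B1\<close> collects the directions orthogonal to a short vector,
    \<open>B2\<close> those with a large triangle. Each has at most \<open>R ^ 3 / 8\<close>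
    members, together at most half of \<open>card U \<ge> R ^ 3 / 2\<close>.\<close>
  have bad: "2 * card {u \<in> U. \<not> good j u} \<le> card U" if j: "j \<in> J" for j
  proof -
    define B1 where "B1 = {(a, b, c) \<in> directions R. \<exists>v1 v2 v3. (v1, v2, v3) \<noteq> (0, 0, 0) \<and> a * v1 + b * v2 + c * v3 = 0 \<and>
      \<bar>v1\<bar> \<le> int A \<and> \<bar>v2\<bar> \<le> int A \<and> \<bar>v3\<bar> \<le> int A}"
    \<comment> \<open>The large triangle satisfies \<open>c * T \<le> 6 * area\<close> for its
      doubled projected area, and \<open>R \<le> 4 * c\<close> turns this into
      \<open>R * T \<le> 24 * area\<close>.\<close>
    define D where "D = real R * real T / 24"
    define B2 where "B2 = {(a, b, c) \<in> directions R. \<exists>p\<in>S j. \<exists>q\<in>S j. \<exists>r\<in>S j.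
       (\<forall>x\<in>{p, q, r}. \<forall>y\<in>S j. a * X y + b * Y y + c * Z y \<le> a * X x + b * Y x + c * Z x) \<and>
       D \<le> real_of_int \<bar>(X q - X p) * (Y r - Y p) - (Y q - Y p) * (X r - X p)\<bar>}"
    have finB: "finite B1" "finite B2"
      by (rule finite_subset[OF _ finite_directions[of R]]; auto simp: B1_def B2_def)+
    have "{u \<in> U. \<not> good j u} \<subseteq> B1 \<union> B2"
    proof (intro subsetI UnCI)
      fix x assume "x \<in> {u \<in> U. \<not> good j u}" "x \<notin> B2"
      moreover obtain a b c where x: "x = (a, b, c)" by (metis prod_cases3)
      ultimately have u: "(a, b, c) \<in> U" "\<not> good j (a, b, c)" "(a, b, c) \<notin> B2" by auto
      let ?F = "top j (a, b, c)"
      have dir: "c > 0" "gcd a (gcd b c) = 1" "int R \<le> 4 * c" using u R1 by (auto simp: U_def directions_def)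
      have m: "int (card ?F) \<ge> int T + 1" using u by (simp add: good_def)
      obtain p0 where p0: "p0 \<in> ?F" using removed'[OF j u(1)] by blast
      have FS: "?F \<subseteq> S j" by (auto simp: top_def)
      have rng: "\<bar>X q - X p\<bar> \<le> int n \<and> \<bar>Y q - Y p\<bar> \<le> int n \<and> \<bar>Z q - Z p\<bar> \<le> int n" if "p \<in> ?F" "q \<in> ?F" for p q
        using box[OF subsetD[OF FS that(1)]] box[OF subsetD[OF FS that(2)]] by auto
      have plane: "a * X p + b * Y p + c * Z p = ht (a, b, c) p0" if "p \<in> ?F" for p
        using that p0 by (auto simp: top_def ht_def intro: antisym)
      have "(\<exists>v1 v2 v3. (v1, v2, v3) \<noteq> (0, 0, 0) \<and> a * v1 + b * v2 + c * v3 = 0 \<and>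
            (int (card ?F) - 1) * \<bar>v1\<bar> \<le> int n \<and> (int (card ?F) - 1) * \<bar>v2\<bar> \<le> int n \<and>
            (int (card ?F) - 1) * \<bar>v3\<bar> \<le> int n) \<or>
         (\<exists>p\<in>?F. \<exists>q\<in>?F. \<exists>r\<in>?F. c * int (card ?F)
            \<le> 6 * \<bar>(X q - X p) * (Y r - Y p) - (Y q - Y p) * (X r - X p)\<bar>)"
        using m T rng plane
        by (intro thin_or_large_triangle[OF fintop _ inj_on_subset[OF inj FS] dir(2,1)]) auto
      then show "x \<in> B1"
      proof
        assume "\<exists>v1 v2 v3. (v1, v2, v3) \<noteq> (0, 0, 0) \<and> a * v1 + b * v2 + c * v3 = 0 \<and>
            (int (card ?F) - 1) * \<bar>v1\<bar> \<le> int n \<and> (int (card ?F) - 1) * \<bar>v2\<bar> \<le> int n \<and>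
            (int (card ?F) - 1) * \<bar>v3\<bar> \<le> int n"
        then obtain v1 v2 v3 where v: "(v1, v2, v3) \<noteq> (0, 0, 0)" "a * v1 + b * v2 + c * v3 = 0"
          "(int (card ?F) - 1) * \<bar>v1\<bar> \<le> int n" "(int (card ?F) - 1) * \<bar>v2\<bar> \<le> int n"
          "(int (card ?F) - 1) * \<bar>v3\<bar> \<le> int n" by (elim exE conjE)
        have "\<bar>v\<bar> \<le> int A" if "(int (card ?F) - 1) * \<bar>v\<bar> \<le> int n" for v
        proof -
          have "int T * \<bar>v\<bar> \<le> (int (card ?F) - 1) * \<bar>v\<bar>" using m by (intro mult_right_mono) auto
          also have "\<dots> \<le> int (A * T)" using that AT by linarith
          finally have "int T * \<bar>v\<bar> \<le> int T * int A" by (simp add: mult.commute)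
          then show ?thesis using T by simp
        qed
        note small = this[OF v(3)] this[OF v(4)] this[OF v(5)]
        show ?thesis using u(1) unfolding B1_def U_def x mem_Collect_eq prod.case
          by (intro conjI exI[of _ v1] exI[of _ v2] exI[of _ v3] v small)
      next
        assume "\<exists>p\<in>?F. \<exists>q\<in>?F. \<exists>r\<in>?F. c * int (card ?F)
            \<le> 6 * \<bar>(X q - X p) * (Y r - Y p) - (Y q - Y p) * (X r - X p)\<bar>"
        then obtain p q r where pqr: "p \<in> ?F" "q \<in> ?F" "r \<in> ?F"
          and le: "c * int (card ?F) \<le> 6 * \<bar>(X q - X p) * (Y r - Y p) - (Y q - Y p) * (X r - X p)\<bar>" by blast
        have "int R * int T \<le> (4 * c) * int (card ?F)" using dir m by (intro mult_mono) auto
        also have "\<dots> \<le> 24 * \<bar>(X q - X p) * (Y r - Y p) - (Y q - Y p) * (X r - X p)\<bar>" using le by simp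
        finally have "real_of_int (int R * int T) \<le> real_of_int (24 * \<bar>(X q - X p) * (Y r - Y p) - (Y q - Y p) * (X r - X p)\<bar>)"
          by (simp only: of_int_le_iff)
        then have "D \<le> real_of_int \<bar>(X q - X p) * (Y r - Y p) - (Y q - Y p) * (X r - X p)\<bar>" unfolding D_def by simp
        moreover have "p \<in> S j" "q \<in> S j" "r \<in> S j" using pqr FS by auto
        moreover have "\<forall>x\<in>{p, q, r}. \<forall>y\<in>S j. a * X y + b * Y y + c * Z y \<le> a * X x + b * Y x + c * Z x"
          using pqr by (auto simp: top_def ht_def)
        ultimately have "(a, b, c) \<in> B2" using u(1) unfolding B2_def U_def mem_Collect_eq prod.case
          by (intro conjI bexI[of _ p] bexI[of _ q] bexI[of _ r])
        with u(3) show ?thesis by simp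
      qed
    qed
    from card_mono[OF _ this] finB have "card {u \<in> U. \<not> good j u} \<le> card B1 + card B2"
      using card_Un_le[of B1 B2] by (meson finite_UnI order_trans)
    moreover have "8 * real (card B1) \<le> real R ^ 3"
    proof -
      have "8 * card B1 \<le> 8 * ((2 * A + 1) ^ 3 * R ^ 2)"
        using card_directions_orthogonal[of R A] by (simp add: B1_def)
      also have "\<dots> = (8 * (2 * A + 1) ^ 3) * R ^ 2" by simp
      also have "\<dots> \<le> R * R ^ 2" using R by (intro mult_right_mono) auto
      finally have "8 * card B1 \<le> R ^ 3" by (simp add: power3_eq_cube power2_eq_square)
      then have "real (8 * card B1) \<le> real (R ^ 3)" by (simp only: of_nat_le_iff)
      then show ?thesis by simp
    qed
    moreover have "8 * real (card B2) \<le> real R ^ 3"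
    proof -
      have "real (card B2) * D \<le> 2 * (real n)\<^sup>2"
      proof (rule disjoint_triangles_bound[where S = "S j" and Z = Z, OF finB(2)])
        show "c > 0 \<and> gcd a (gcd b c) = 1" if "(a, b, c) \<in> B2" for a b c
          using that by (auto simp: B2_def directions_def)
        show "X p \<in> {0..int n} \<and> Y p \<in> {0..int n}" if "p \<in> S j" for p using box[OF that] by auto
      qed (simp add: B2_def)
      \<comment> \<open>384 is \<open>8 * 2 * 24\<close>: the wanted eighth, the 2 of the packing
        bound, and the 24 in \<open>D\<close>.\<close>
      moreover have "real (384 * n ^ 2) \<le> real (R ^ 4 * T)" using RT by (simp only: of_nat_le_iff)
      ultimately have "(8 * real (card B2)) * (real R * real T) \<le> real R ^ 3 * (real R * real T)"
        unfolding D_def by (simp add: algebra_simps power4_eq_xxxx power3_eq_cube)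
      moreover have "real R * real T > 0" using R1 T by simp
      ultimately show ?thesis by (simp only: mult_le_cancel_right_pos)
    qed
    ultimately have "2 * real (card {u \<in> U. \<not> good j u}) \<le> real (card U)" using cardU by linarith
    then show ?thesis by linarith
  qed

  have good: "card {j \<in> J. good j u} \<le> 3 * n * R * T" if u: "u \<in> U" for u
  proof -
    define hm where "hm j = Max (ht u ` S j)" for j
    have hm: "p \<in> top j u \<longleftrightarrow> p \<in> S j \<and> ht u p = hm j" if "j \<in> J" for j p
    proof -
      have "S j \<noteq> {}" using removed'[OF that u] by (auto simp: top_def)
      then show ?thesis unfolding top_def hm_def using fin[of j]
        by (auto intro!: Max_eqI[symmetric] simp: Max_ge)
    qed
    have rng: "hm j \<in> {1..int (3 * n * R)}" if j: "j \<in> J" for j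
    proof -
      obtain a b c where abc: "u = (a, b, c)" by (metis prod_cases3)
      have pos: "a \<in> {1..int R}" "b \<in> {1..int R}" "c \<in> {1..int R}" using u abc by (auto simp: U_def directions_def)
      obtain p where p: "p \<in> S j" "hm j = ht u p" using removed'[OF j u] hm[OF j] by metis
      have *: "1 \<le> s * x \<and> s * x \<le> int R * int n" if "s \<in> {1..int R}" "x \<in> {1..int n}" for s x
        using that mult_mono[of s "int R" x "int n"] mult_mono[of 1 s 1 x] by auto
      show ?thesis using *[OF pos(1), of "X p"] *[OF pos(2), of "Y p"] *[OF pos(3), of "Z p"] box[OF p(1)]
        unfolding p(2) abc ht_def by (auto simp: algebra_simps)
    qed
    \<comment> \<open>This pair never repeats: at equal maximal height the later top face is
      contained in the earlier one, and strictly, since a point of the earlier face was removed in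
      between.\<close>
    let ?f = "\<lambda>j. (hm j, card (top j u))"
    have "?f ` {j \<in> J. good j u} \<subseteq> {1..int (3 * n * R)} \<times> {1..T}"
    proof clarify
      fix j assume j: "j \<in> J" "good j u"
      then have "card (top j u) \<noteq> 0" using removed'[OF j(1) u] fintop by auto
      then show "hm j \<in> {1..int (3 * n * R)} \<and> card (top j u) \<in> {1..T}" using j rng by (auto simp: good_def)
    qed
    moreover have less: "?f j \<noteq> ?f k" if jk: "j \<in> J" "k \<in> J" "j < k" for j k
    proof
      assume eq: "?f j = ?f k"
      obtain p where p: "p \<in> top j u" "p \<notin> S (Suc j)" using removed'[OF jk(1) u] by blast
      have "top k u \<subseteq> top j u" using hm[OF jk(1)] hm[OF jk(2)] eq dec[of j k] jk by auto
      moreover have "p \<notin> top k u" using p dec[of "Suc j" k] jk by (auto simp: top_def)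
      ultimately have "top k u \<subset> top j u" using p by blast
      from psubset_card_mono[OF fintop this] eq show False by simp
    qed
    then have "inj_on ?f {j \<in> J. good j u}"
      by (intro inj_onI) (metis (mono_tags, lifting) linorder_neqE_nat mem_Collect_eq)
    ultimately have "card {j \<in> J. good j u} \<le> card ({1..int (3 * n * R)} \<times> {1..T})"
      by (intro card_inj_on_le) auto
    then show ?thesis by (simp add: card_cartesian_product nat_mult_distrib)
  qed

  have "card J * card U \<le> (\<Sum>j\<in>J. 2 * card {u \<in> U. good j u})"
  proof -
    have "card U \<le> 2 * card {u \<in> U. good j u}" if "j \<in> J" for j
    proof -
      have "card U = card ({u \<in> U. good j u} \<union> {u \<in> U. \<not> good j u})" by (rule arg_cong[of _ _ card]) auto
      also have "\<dots> \<le> card {u \<in> U. good j u} + card {u \<in> U. \<not> good j u}" by (rule card_Un_le)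
      finally show ?thesis using bad[OF that] by linarith
    qed
    from sum_mono[OF this] show ?thesis by simp
  qed
  also have "\<dots> = 2 * (\<Sum>j\<in>J. \<Sum>u\<in>U. if good j u then 1 else 0)"
    using finU by (simp add: sum_distrib_left[symmetric] sum.If_cases Int_def)
  also have "\<dots> = 2 * (\<Sum>u\<in>U. \<Sum>j\<in>J. if good j u then 1 else 0)"
    by (subst sum.swap) simp
  also have "\<dots> = 2 * (\<Sum>u\<in>U. card {j \<in> J. good j u})"
    using finJ by (simp add: sum.If_cases Int_def)
  also have "\<dots> \<le> 2 * (\<Sum>u\<in>U. 3 * n * R * T)"
    by (intro mult_left_mono sum_mono good) auto
  also have "\<dots> = (6 * n * R * T) * card U" by simp
  finally have "card J * card U \<le> (6 * n * R * T) * card U" .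
  moreover have "card U > 0" using cardU R1 by (intro Nat.gr0I) auto
  ultimately show ?thesis by simp
qed

subsection \<open>Slicing the grid\<close>

text \<open>When the level \<open>t\<close> is attained, its points span a face of the hull, and
  extreme points of a face are extreme in the whole. The lemma is used twice in a row: for a
  direction inside a slice, then for the slice itself.\<close>

lemma ext_exposed_subset:
  fixes Y :: "'a::euclidean_space set"
  assumes fin: "finite Y" and le: "\<And>y. y \<in> Y \<Longrightarrow> w \<bullet> y \<le> t"
  shows "ext {y \<in> Y. w \<bullet> y = t} \<subseteq> ext Y"
proof -
  let ?E = "{y \<in> Y. w \<bullet> y = t}" and ?F = "convex hull Y \<inter> {x. w \<bullet> x = t}"
  have "convex hull Y \<subseteq> {x. w \<bullet> x \<le> t}"
    using le by (intro hull_minimal convex_halfspace_le) auto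
  then have face: "?F face_of convex hull Y"
    by (intro face_of_Int_supporting_hyperplane_le) auto
  then obtain T where T: "T \<subseteq> Y" "?F = convex hull T"
    using face_of_convex_hull_subset[OF finite_imp_compact[OF fin]] by blast
  have "T \<subseteq> ?E" using hull_subset[of T convex] T by blast
  then have "?F \<subseteq> convex hull ?E" using T hull_mono by metis
  moreover have "convex hull ?E \<subseteq> ?F"
    by (intro hull_minimal convex_Int convex_convex_hull convex_hyperplane) (auto simp: hull_inc)
  ultimately have "convex hull ?E = ?F" by (rule antisym[rotated])
  then show ?thesis unfolding ext_def using extreme_point_of_face[OF face] by auto
qed

text \<open>The forbidden \<open>w\<close> form finitely many hyperplanes, a set of measure
  zero.\<close>

lemma generic_functional:
  fixes D :: "'a::euclidean_space set"
  assumes "finite D" "0 \<notin> D"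
  obtains w where "\<And>d. d \<in> D \<Longrightarrow> w \<bullet> d \<noteq> 0"
proof -
  have "negligible (\<Union>((\<lambda>d. {x. d \<bullet> x = 0}) ` D))"
    using assms by (intro negligible_Union) (auto intro!: negligible_hyperplane)
  then have "(\<Union>((\<lambda>d. {x. d \<bullet> x = 0}) ` D)) \<noteq> UNIV"
    using non_negligible_UNIV by metis
  then obtain w where "w \<notin> (\<Union>((\<lambda>d. {x. d \<bullet> x = 0}) ` D))" by blast
  then show thesis by (intro that[of w]) (auto simp: inner_commute)
qed

lemma peel_antimono: "j \<le> k \<Longrightarrow> peel X k \<subseteq> peel X j"
  by (rule lift_Suc_antimono_le[of "peel X"]) auto

text \<open>A functional \<open>f\<close> that ignores three coordinates and separates the values of
  the others cuts the grid into at most \<open>n ^ (CARD('d) - 3)\<close> three-dimensional slices.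
  Each step is charged to the slice where \<open>f\<close> is maximal on the remaining points, and
  \<open>peeling_steps_3d\<close> bounds the charge of each slice.\<close>

lemma layer_number_grid_le:
  assumes d: "CARD('d::finite) \<ge> 3"
    and AT: "n \<le> A * T" and T: "T \<ge> 1" and R: "8 * (2 * A + 1) ^ 3 \<le> R"
    and RT: "384 * n ^ 2 \<le> R ^ 4 * T"
  shows "layer_number (grid n :: (real ^ 'd) set) \<le> n ^ (CARD('d) - 3) * (6 * n * R * T)"
proof -
  let ?G = "grid n :: (real ^ 'd) set"
  obtain I :: "'d set" where I: "card I = 3"
    using obtain_subset_with_card_n[OF d] by blast
  then obtain i1 i2 i3 where I_eq: "I = {i1, i2, i3}" and ne: "i1 \<noteq> i2" "i1 \<noteq> i3" "i2 \<noteq> i3"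
    by (auto simp: card_3_iff)
  define P :: "real ^ 'd \<Rightarrow> real ^ 'd" where "P x = (\<chi> i. if i \<in> I then 0 else x $ i)" for x
  have P_nth: "P x $ i = x $ i" if "i \<notin> I" for x i using that by (simp add: P_def)
  have "finite ((\<lambda>(x, y). P x - P y) ` (?G \<times> ?G) - {0})" using finite_grid by blast
  then obtain w where w: "\<And>d. d \<in> (\<lambda>(x, y). P x - P y) ` (?G \<times> ?G) - {0} \<Longrightarrow> w \<bullet> d \<noteq> 0"
    by (rule generic_functional) auto
  \<comment> \<open>Using \<open>P w\<close> in place of \<open>w\<close> makes \<open>f\<close>
    blind to the coordinates in \<open>I\<close>, while it stays an inner product, as
    \<open>ext_exposed_subset\<close> requires.\<close>
  define f where "f x = P w \<bullet> x" for x
  have f_P: "f x = w \<bullet> P x" for x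
    unfolding f_def P_def inner_vec_def by (intro sum.cong) auto
  have f_inj: "P x = P y" if "x \<in> ?G" "y \<in> ?G" "f x = f y" for x y
  proof (rule ccontr)
    assume "P x \<noteq> P y"
    then have "P x - P y \<in> (\<lambda>(x, y). P x - P y) ` (?G \<times> ?G) - {0}" using that by auto
    from w[OF this] show False using that(3) by (simp add: f_P inner_diff_right)
  qed
  have cardV: "card (f ` ?G) \<le> n ^ (CARD('d) - 3)"
  proof -
    let ?E = "(- I) \<rightarrow>\<^sub>E real ` {1..n}"
    have finE: "finite ?E" by (intro finite_PiE) auto
    have "f ` ?G \<subseteq> (\<lambda>g. w \<bullet> (\<chi> i. if i \<in> I then 0 else g i)) ` ?E"
    proof clarify
      fix x assume "x \<in> ?G"
      then have E: "restrict (\<lambda>i. x $ i) (- I) \<in> ?E" by (auto simp: grid_def)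
      have "P x = (\<chi> i. if i \<in> I then 0 else restrict (\<lambda>i. x $ i) (- I) i)"
        by (auto simp: P_def vec_eq_iff)
      then show "f x \<in> (\<lambda>g. w \<bullet> (\<chi> i. if i \<in> I then 0 else g i)) ` ?E"
        by (intro image_eqI[OF _ E]) (simp only: f_P)
    qed
    from surj_card_le[OF finE this] have "card (f ` ?G) \<le> card ?E" .
    also have "\<dots> = n ^ (CARD('d) - 3)"
      using I by (subst card_PiE) (auto simp: card_image inj_on_def Compl_eq_Diff_UNIV card_Diff_subset)
    finally show ?thesis .
  qed

  define N where "N = layer_number ?G"
  have sub: "peel ?G j \<subseteq> ?G" for j using peel_antimono[of 0 j ?G] by simp
  have finp: "finite (peel ?G j)" for j using finite_subset[OF sub finite_grid] .
  have nonempty: "peel ?G j \<noteq> {}" if "j < N" for j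
    using not_less_Least[of j "\<lambda>i. peel ?G i = {}"] that by (simp add: N_def layer_number_def)
  define m where "m j = Max (f ` peel ?G j)" for j
  have m_in: "m j \<in> f ` peel ?G j" if "j < N" for j
    unfolding m_def using nonempty[OF that] finp by (intro Max_in) auto
  have m_ge: "f x \<le> m j" if "x \<in> peel ?G j" for x j
    unfolding m_def using that finp by (intro Max_ge) auto

  have fibre: "card {j \<in> {..<N}. m j = t} \<le> 6 * n * R * T" for t
  proof -
    \<comment> \<open>The slice at level \<open>t\<close> is followed through the whole peeling, but
      only the steps at which it is the top level are counted.\<close>
    define S where "S j = {y \<in> peel ?G j. f y = t}" for j
    define X where "X i p = \<lfloor>p $ i\<rfloor>" for i and p :: "real ^ 'd"
    have SG: "S j \<subseteq> ?G" for j using sub by (auto simp: S_def)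
    have X: "of_int (X i p) = p $ i" "X i p \<in> {1..int n}" if "p \<in> ?G" for i p
    proof -
      have "p $ i \<in> real ` {1..n}" using that by (simp add: grid_def)
      then obtain k where "p $ i = real k" "k \<in> {1..n}" by (rule imageE)
      then show "of_int (X i p) = p $ i" "X i p \<in> {1..int n}" by (auto simp: X_def)
    qed
    show ?thesis
    proof (rule peeling_steps_3d[where S = S and X = "X i1" and Y = "X i2" and Z = "X i3", OF _ _ _ _ _ _ AT T R RT])
      show "finite (S j)" for j using finp by (simp add: S_def)
      show "S k \<subseteq> S j" if "j \<le> k" for j k using peel_antimono[OF that, of ?G] by (auto simp: S_def)
      show "X i1 p \<in> {1..int n} \<and> X i2 p \<in> {1..int n} \<and> X i3 p \<in> {1..int n}" if "p \<in> S j" for j p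
        using X(2) SG that by blast
      show "inj_on (\<lambda>p. (X i1 p, X i2 p, X i3 p)) (S j)" for j
      proof (rule inj_onI)
        fix p q assume p: "p \<in> S j" and q: "q \<in> S j" and eq: "(X i1 p, X i2 p, X i3 p) = (X i1 q, X i2 q, X i3 q)"
        have pG: "p \<in> ?G" "q \<in> ?G" using p q SG by auto
        have "P p = P q" using f_inj[OF pG] p q by (simp add: S_def)
        then have "p $ i = q $ i" if "i \<notin> I" for i
          using P_nth[OF that, of p] P_nth[OF that, of q] by simp
        moreover have "p $ i = q $ i" if "i \<in> I" for i
          using eq that X(1)[OF pG(1), of i] X(1)[OF pG(2), of i] by (auto simp: I_eq)
        ultimately show "p = q" by (auto simp: vec_eq_iff)
      qed
      fix j and a b c :: int
      assume "j \<in> {j \<in> {..<N}. m j = t}"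
      then have j: "j < N" "m j = t" by auto
      define u :: "real ^ 'd" where "u = axis i1 (of_int a) + axis i2 (of_int b) + axis i3 (of_int c)"
      have u: "u \<bullet> p = of_int (a * X i1 p + b * X i2 p + c * X i3 p)" if "p \<in> ?G" for p
        using X(1)[OF that] by (simp add: u_def inner_add_left inner_axis')
      have Sne: "S j \<noteq> {}" using m_in[OF j(1)] j by (auto simp: S_def)
      have finS: "finite (S j)" using finp by (simp add: S_def)
      define h where "h = Max ((\<bullet>) u ` S j)"
      have h_in: "h \<in> (\<bullet>) u ` S j" unfolding h_def using Sne finS by (intro Max_in) auto
      have h_ge: "u \<bullet> x \<le> h" if "x \<in> S j" for x unfolding h_def using that finS by (intro Max_ge) auto
      \<comment> \<open>An extreme point of this top face is extreme in the slice and then, the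
        slice being the top level of \<open>f\<close>, extreme among all remaining points. Hence
        this step removes it.\<close>
      let ?E = "{y \<in> S j. u \<bullet> y = h}"
      have "?E \<noteq> {}" using h_in by auto
      then obtain x where x: "x \<in> ext ?E" using ext_nonempty[of ?E] finS by auto
      have xE: "x \<in> S j" "u \<bullet> x = h" using ext_subset[of ?E] x by auto
      have "x \<in> ext (S j)" using ext_exposed_subset[OF finS h_ge] x by blast
      then have "x \<in> ext (peel ?G j)"
        using ext_exposed_subset[of "peel ?G j" "P w" t] finp m_ge[of _ j] j
        unfolding S_def f_def by blast
      then have "x \<in> S j - S (Suc j)" using xE by (simp add: S_def)
      moreover have "a * X i1 q + b * X i2 q + c * X i3 q \<le> a * X i1 x + b * X i2 x + c * X i3 x" if "q \<in> S j" for q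
      proof -
        have "u \<bullet> q \<le> u \<bullet> x" using h_ge[OF that] xE by simp
        then show ?thesis using u[of q] u[of x] that xE SG by (metis of_int_le_iff subsetD)
      qed
      ultimately show "\<exists>p\<in>S j - S (Suc j). \<forall>q\<in>S j. a * X i1 q + b * X i2 q + c * X i3 q \<le> a * X i1 p + b * X i2 p + c * X i3 p"
        by blast
    qed simp
  qed
  have "card {..<N} \<le> card (m ` {..<N}) * (6 * n * R * T)"
    by (rule card_le_fibres) (use fibre in auto)
  also have "\<dots> \<le> card (f ` ?G) * (6 * n * R * T)"
    using m_in sub finite_grid by (intro mult_right_mono card_mono finite_imageI) blast+
  also have "\<dots> \<le> n ^ (CARD('d) - 3) * (6 * n * R * T)"
    using cardV by (intro mult_right_mono) auto
  finally show ?thesis by (simp add: N_def)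
qed

section \<open>Choice of the parameters and the resulting exponent\<close>

theorem theorem4:
  assumes "CARD('d::finite) \<ge> 3"
  shows "\<exists>C>0. \<forall>\<^sub>F n in sequentially.
    real (layer_number (grid n :: (real ^ 'd) set)) \<le> C * real n powr (real CARD('d) - 9 / 11)"
\<comment> \<open>10368 is \<open>6 * 216 * 4 * 2\<close>: the 6 of the step bound, the 216 in
  \<open>R\<close>, then \<open>A ^ 2 \<le> 4 * x ^ 2\<close> and
  \<open>A * T \<le> 2 * n\<close>.\<close>
proof (intro exI[of _ 10368] conjI)
  show "\<forall>\<^sub>F n in sequentially.
    real (layer_number (grid n :: (real ^ 'd) set)) \<le> 10368 * real n powr (real CARD('d) - 9 / 11)"
    using eventually_ge_at_top[of 1]
  proof eventually_elim
    case (elim n)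
    \<comment> \<open>With \<open>R\<close> of order \<open>A ^ 3\<close> and \<open>T\<close> of
      order \<open>n / A\<close>, the requirement \<open>384 * n ^ 2 \<le> R ^ 4 * T\<close> asks
      for \<open>A ^ 11\<close> of order \<open>n\<close>.\<close>
    define x where "x = real n powr (1 / 11)"
    define A where "A = nat \<lceil>x\<rceil>"
    \<comment> \<open>216 is \<open>8 * 3 ^ 3\<close>, using
      \<open>2 * A + 1 \<le> 3 * A\<close>.\<close>
    define R where "R = 216 * A ^ 3"
    define T where "T = nat \<lceil>real n / real A\<rceil>"
    have x: "x \<ge> 1" unfolding x_def using elim by (intro ge_one_powr_ge_zero) auto
    have x11: "x ^ 11 = real n" unfolding x_def using elim by (simp add: powr_power)
    have A: "x \<le> real A" "real A \<le> x + 1" using x unfolding A_def by linarith+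
    then have A1: "A \<ge> 1" using x by linarith
    have "x \<le> real n" using power_increasing[of 1 11 x] x x11 by simp
    then have An: "A \<le> n" unfolding A_def by (simp add: ceiling_le_iff nat_le_iff)
    have T: "real n / real A \<le> real T" "real T \<le> real n / real A + 1"
      unfolding T_def using divide_nonneg_nonneg[of "real n" "real A"] by linarith+
    have AT: "real n \<le> real A * real T" using T(1) A1 by (simp add: field_simps)
    have "real T * real A \<le> (real n / real A + 1) * real A" using T(2) by (intro mult_right_mono) auto
    also have "\<dots> = real n + real A" using A1 by (simp add: field_simps)
    finally have AT': "real A * real T \<le> 2 * real n" using An by (simp add: mult.commute)
    have ATn: "n \<le> A * T" using AT by (metis of_nat_le_iff of_nat_mult)
    then have T1: "T \<ge> 1" using elim by (cases T) auto
    have R8: "8 * (2 * A + 1) ^ 3 \<le> R"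
    proof -
      have "(2 * A + 1) ^ 3 \<le> (3 * A) ^ 3" using A1 by (intro power_mono) auto
      then show ?thesis by (simp add: R_def power_mult_distrib)
    qed
    have RT: "384 * n ^ 2 \<le> R ^ 4 * T"
    proof -
      have "real n \<le> real A ^ 11" using power_mono[OF A(1), of 11] x x11 by simp
      then have "n \<le> A ^ 11" by (metis of_nat_le_iff of_nat_power)
      \<comment> \<open>\<open>R ^ 4\<close> contributes \<open>A ^ 12\<close>, split as
        \<open>A ^ 11 * A\<close>: the first factor dominates one \<open>n\<close>, and the second
        together with \<open>T\<close> the other.\<close>
      have "384 * n ^ 2 \<le> 216 ^ 4 * (n * n)" by (simp add: power2_eq_square)
      also have "\<dots> \<le> 216 ^ 4 * (A ^ 11 * (A * T))"
        using \<open>n \<le> A ^ 11\<close> ATn by (intro mult_left_mono mult_mono) auto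
      also have "\<dots> = R ^ 4 * T" by (simp add: R_def power_mult_distrib power_numeral_reduce flip: power_mult)
      finally show ?thesis .
    qed
    have "real (6 * n * R * T) = 1296 * real n * (real A ^ 2 * (real A * real T))"
      by (simp add: R_def power2_eq_square power3_eq_cube)
    also have "\<dots> \<le> 1296 * real n * ((2 * x) ^ 2 * (2 * real n))"
    proof (intro mult_left_mono)
      have "real A ^ 2 \<le> (2 * x) ^ 2" using A x by (intro power_mono) auto
      from mult_mono[OF this AT'] show "real A ^ 2 * (real A * real T) \<le> (2 * x) ^ 2 * (2 * real n)"
        by simp
    qed simp
    also have "\<dots> = 10368 * (real n ^ 2 * x ^ 2)" by (simp add: power2_eq_square)
    also have "real n ^ 2 * x ^ 2 = real n powr (2 + 2 / 11)"
      using elim by (simp only: powr_add) (simp add: x_def powr_power)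
    finally have b: "real (6 * n * R * T) \<le> 10368 * real n powr (2 + 2 / 11)" .
    have "real (layer_number (grid n :: (real ^ 'd) set)) \<le> real (n ^ (CARD('d) - 3) * (6 * n * R * T))"
      using layer_number_grid_le[OF assms ATn T1 R8 RT] by (simp only: of_nat_le_iff)
    also have "\<dots> = real n ^ (CARD('d) - 3) * real (6 * n * R * T)" by simp
    also have "\<dots> \<le> real n ^ (CARD('d) - 3) * (10368 * real n powr (2 + 2 / 11))"
      using b by (intro mult_left_mono) auto
    also have "\<dots> = 10368 * real n powr (real (CARD('d) - 3) + (2 + 2 / 11))"
      using elim powr_add[of "real n" "real (CARD('d) - 3)" "2 + 2 / 11"] by (simp add: powr_realpow)
    also have "real (CARD('d) - 3) + (2 + 2 / 11) = real CARD('d) - 9 / 11"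
      using assms by (simp add: of_nat_diff)
    finally show ?case .
  qed
qed simp

end
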